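(* Let $T:X\to X$ be a uniquely ergodic homeomorphism of a compact metric space $X$, let $l\ge 1$, and let $\Psi:X\to U(l)$ and $\rho:X\to\mathbb{R}^l$ be continuous. Suppose that the twisted cohomological equation $$u(Tx)-\Psi(x)u(x)=\rho(x)\quad\text{for all }x\in X$$ has a continuous solution $u:X\to\mathbb{R}^l$. For $\lambda\in[0,1)$ let $u_\lambda:X\to\mathbb{R}^l$ be the unique continuous solution of $\lambda u_\lambda(Tx)-\Psi(x)u_\lambda(x)=\rho(x)$ for all $x\in X$. Let $\tilde T:X\times U(l)\to X\times U(l)$ be the extension $\tilde T(x,A)=(Tx,A\Psi(x)^{-1})$. (a) If $\tilde T$ is uniquely ergodic, then there exists a continuous map $u^*:X\to\mathbb{R}^l$ such that $\lim_{\lambda\to1^-}u_\lambda(x)=u^*(x)$ uniformly in $x\in X$. Moreover, $u^*$ is a continuous solution of the twisted cohomological equation and has uniform-exponential zero mean. (b) If there exists a continuous $\tilde T$-invariant section, then there exists a continuous map $u^*:X\to\mathbb{R}^l$ such that $\lim_{\lambda\to1^-}u_\lambda(x)=u^*(x)$ uniformly in $x\in X$. Moreover, $u^*$ is a continuous solution of the twisted cohomological equation and has uniform-exponential zero mean.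
   Context: $U(l)$ denotes the orthogonal group of $\mathbb{R}^l$ (the group of linear isometries of $\mathbb{R}^l$). A homeomorphism of a compact metric space is uniquely ergodic if it has exactly one invariant Borel probability measure. The unique continuous solution of the hyperbolized equation is $u_\lambda(x)=-\sum_{j\ge0}\lambda^j\Psi(x)^{-1}\Psi(Tx)^{-1}\cdots\Psi(T^jx)^{-1}\rho(T^jx)$. A continuous $\tilde T$-invariant section is a continuous map $\mathcal{X}:X\to U(l)$ with $\tilde T(x,\mathcal{X}(x))=(Tx,\mathcal{X}(Tx))$ for all $x\in X$, i.e. $\mathcal{X}(Tx)=\mathcal{X}(x)\Psi(x)^{-1}$. A bounded function $u:X\to\mathbb{R}^l$ has uniform-exponential zero mean if $\lim_{\lambda\to1^-}\mathcal{S}_\lambda(u,x)=0$ uniformly in $x\in X$, where $\mathcal{S}_\lambda(u,x)=(1-\lambda)\sum_{j\ge0}\lambda^j\Psi(x)^{-1}\cdots\Psi(T^jx)^{-1}u(T^{j+1}x)$. *)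

theory Defs
  imports "HOL-Probability.Probability"
begin

text \<open>Linear isometries of \<open>\<real>\<^sup>l\<close> are represented by their matrices, with the usual
  topology of \<^typ>\<open>real^'l^'l\<close>.\<close>

definition orthogonal_group :: "(real^'l^'l) set" where
  "orthogonal_group = {A. orthogonal_matrix A}"

lemma in_orthogonal_group_iff:
  "A \<in> orthogonal_group \<longleftrightarrow> orthogonal_transformation ((*v) A)"
  by (simp add: orthogonal_group_def orthogonal_transformation_matrix)

text \<open>Borel measures on \<open>S\<close> are measures on the trace of the Borel sets, so that no measure outside
  \<open>S\<close> is involved and \<open>\<exists>!\<close> is genuine equality of measures.\<close>

definition invariant_prob :: "'a::topological_space set \<Rightarrow> ('a \<Rightarrow> 'a) \<Rightarrow> 'a measure \<Rightarrow> bool" where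
  "invariant_prob S f M \<longleftrightarrow>
     prob_space M \<and> sets M = sets (restrict_space borel S) \<and>
     f \<in> measurable M M \<and> distr M M f = M"

definition uniquely_ergodic :: "'a::topological_space set \<Rightarrow> ('a \<Rightarrow> 'a) \<Rightarrow> bool" where
  "uniquely_ergodic S f \<longleftrightarrow> (\<exists>!M. invariant_prob S f M)"

definition twisted_solution ::
  "'a::topological_space set \<Rightarrow> ('a \<Rightarrow> 'a) \<Rightarrow> ('a \<Rightarrow> real^'l^'l) \<Rightarrow> ('a \<Rightarrow> real^'l) \<Rightarrow> ('a \<Rightarrow> real^'l) \<Rightarrow> bool"
where
  "twisted_solution X T \<Psi> \<rho> u \<longleftrightarrow>
     continuous_on X u \<and> (\<forall>x\<in>X. u (T x) - \<Psi> x *v u x = \<rho> x)"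

definition hyperbolized_solution ::
  "'a::topological_space set \<Rightarrow> ('a \<Rightarrow> 'a) \<Rightarrow> ('a \<Rightarrow> real^'l^'l) \<Rightarrow> ('a \<Rightarrow> real^'l) \<Rightarrow> real \<Rightarrow> ('a \<Rightarrow> real^'l) \<Rightarrow> bool"
where
  "hyperbolized_solution X T \<Psi> \<rho> s u \<longleftrightarrow>
     continuous_on X u \<and> (\<forall>x\<in>X. s *\<^sub>R u (T x) - \<Psi> x *v u x = \<rho> x)"

text \<open>\<^const>\<open>extensional\<close> fixes the irrelevant values outside \<open>X\<close>, so that uniqueness of the
  solution as a function on \<open>X\<close> is uniqueness of the HOL function.\<close>

definition u_hyp ::
  "'a::topological_space set \<Rightarrow> ('a \<Rightarrow> 'a) \<Rightarrow> ('a \<Rightarrow> real^'l^'l) \<Rightarrow> ('a \<Rightarrow> real^'l) \<Rightarrow> real \<Rightarrow> 'a \<Rightarrow> real^'l"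
where
  "u_hyp X T \<Psi> \<rho> s = (THE u. u \<in> extensional X \<and> hyperbolized_solution X T \<Psi> \<rho> s u)"

definition skew_extension ::
  "('a \<Rightarrow> 'a) \<Rightarrow> ('a \<Rightarrow> real^'l^'l) \<Rightarrow> 'a \<times> (real^'l^'l) \<Rightarrow> 'a \<times> (real^'l^'l)" where
  "skew_extension T \<Psi> = (\<lambda>(x, A). (T x, A ** matrix_inv (\<Psi> x)))"

definition invariant_section ::
  "'a::topological_space set \<Rightarrow> ('a \<Rightarrow> 'a) \<Rightarrow> ('a \<Rightarrow> real^'l^'l) \<Rightarrow> ('a \<Rightarrow> real^'l^'l) \<Rightarrow> bool" where
  "invariant_section X T \<Psi> \<X> \<longleftrightarrow>
     continuous_on X \<X> \<and> \<X> ` X \<subseteq> orthogonal_group \<and>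
     (\<forall>x\<in>X. skew_extension T \<Psi> (x, \<X> x) = (T x, \<X> (T x)))"

text \<open>\<open>inv_cocycle T \<Psi> j x = \<Psi>(x)\<inverse> \<Psi>(T x)\<inverse> \<cdots> \<Psi>(T\<^sup>j x)\<inverse>\<close>, with \<open>j + 1\<close> factors.\<close>

primrec inv_cocycle :: "('a \<Rightarrow> 'a) \<Rightarrow> ('a \<Rightarrow> real^'l^'l) \<Rightarrow> nat \<Rightarrow> 'a \<Rightarrow> real^'l^'l" where
  "inv_cocycle T \<Psi> 0 x = matrix_inv (\<Psi> x)"
| "inv_cocycle T \<Psi> (Suc j) x = inv_cocycle T \<Psi> j x ** matrix_inv (\<Psi> ((T ^^ Suc j) x))"

definition exp_mean ::
  "('a \<Rightarrow> 'a) \<Rightarrow> ('a \<Rightarrow> real^'l^'l) \<Rightarrow> real \<Rightarrow> ('a \<Rightarrow> real^'l) \<Rightarrow> 'a \<Rightarrow> real^'l" where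
  "exp_mean T \<Psi> s u x =
     (1 - s) *\<^sub>R (\<Sum>j. s ^ j *\<^sub>R (inv_cocycle T \<Psi> j x *v u ((T ^^ Suc j) x)))"

definition uniform_exp_zero_mean ::
  "'a set \<Rightarrow> ('a \<Rightarrow> 'a) \<Rightarrow> ('a \<Rightarrow> real^'l^'l) \<Rightarrow> ('a \<Rightarrow> real^'l) \<Rightarrow> bool" where
  "uniform_exp_zero_mean X T \<Psi> u \<longleftrightarrow>
     bounded (u ` X) \<and>
     uniform_limit X (\<lambda>s. exp_mean T \<Psi> s u) (\<lambda>x. 0) (at_left 1)"

end

theory Submission
  imports Defs
begin

text \<open>
  If \<open>u\<close> is any continuous solution, then \<open>u\<^sub>\<lambda> = u - S\<^sub>\<lambda>(u)\<close>, so everything reduces to the uniform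
  convergence of the exponential means \<open>S\<^sub>\<lambda>(u)\<close>; applied to the limit solution \<open>u\<^sup>*\<close>, the same
  identity shows that \<open>S\<^sub>\<lambda>(u\<^sup>*) \<rightarrow> 0\<close>. In case (a), \<open>S\<^sub>\<lambda>(u,x)\<close> is an Abel mean of the function
  \<open>(x,A) \<mapsto> A u(x)\<close> along the orbit of \<open>(x,1)\<close> under the skew extension; in case (b) it is
  \<open>\<X>(x)\<inverse>\<close> times an Abel mean of \<open>\<X> u\<close> along the orbit of \<open>x\<close>. Abel means of a continuous function
  over a uniquely ergodic system converge uniformly: otherwise a weak limit of the geometric
  distributions on bad orbits would be a second invariant measure.

  The weak limit is taken on the real line by Helly's theorem, after writing the compact metric
  space as a continuous image of a compact set of reals.
\<close>

section \<open>Compact metric spaces as continuous images of compact sets of reals\<close>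

text \<open>Digits 0 and 1 in base 3, the first with weight 1. Unlike base 2, later digits cannot
  make up for an earlier one that differs, so distinct sequences have distinct codes.\<close>

definition ternary_code :: "(nat \<Rightarrow> bool) \<Rightarrow> real" where
  "ternary_code b = (\<Sum>i. if b i then (1/3) ^ i else 0)"

lemma summable_ternary: "summable (\<lambda>i. if b i then (1/3) ^ i else (0::real))"
  by (rule summable_comparison_test'[of "\<lambda>i. (1/3) ^ i"]) (auto intro: summable_geometric)

lemma ternary_code_in: "ternary_code b \<in> {0..2}"
proof -
  have "ternary_code b \<le> (\<Sum>i. (1/3::real) ^ i)"
    unfolding ternary_code_def
    by (rule suminf_le) (auto intro: summable_ternary summable_geometric)
  also have "\<dots> \<le> 2" by (subst suminf_geometric) auto
  finally show ?thesis
    unfolding ternary_code_def by (auto intro!: suminf_nonneg summable_ternary)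
qed

text \<open>The first differing digit contributes \<open>(1/3) ^ m\<close> to the difference, and
  all later digits together at most half of that.\<close>

lemma ternary_code_dist:
  assumes "\<And>i. i < m \<Longrightarrow> b i = c i" "b m \<noteq> c m"
  shows "(1/3) ^ m / 2 \<le> dist (ternary_code b) (ternary_code c)"
proof -
  define d where "d i = (if b i then (1/3) ^ i else 0) - (if c i then (1/3) ^ i else (0::real))" for i
  have sd: "summable d"
    unfolding d_def by (intro summable_diff summable_ternary)
  have "ternary_code b - ternary_code c = suminf d"
    unfolding ternary_code_def d_def by (intro suminf_diff summable_ternary)
  also have "\<dots> = (\<Sum>i. d (i + Suc m)) + (\<Sum>i<Suc m. d i)"
    by (rule suminf_split_initial_segment[OF sd])
  also have "(\<Sum>i<Suc m. d i) = d m"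
    using assms(1) by (simp add: d_def)
  finally have eq: "ternary_code b - ternary_code c = (\<Sum>i. d (i + Suc m)) + d m" .
  have dm: "\<bar>d m\<bar> = (1/3) ^ m"
    using assms(2) by (auto simp: d_def)
  have sg: "(\<lambda>i. (1/3::real) ^ (i + Suc m)) sums ((1/3) ^ m / 2)"
    using sums_mult[OF geometric_sums[of "1/3::real"], of "(1/3) ^ Suc m"]
    by (simp add: power_add mult_ac)
  have "norm (\<Sum>i. d (i + Suc m)) \<le> (\<Sum>i. (1/3::real) ^ (i + Suc m))"
    by (rule norm_suminf_le[OF _ sums_summable[OF sg]]) (auto simp: d_def)
  then have "\<bar>\<Sum>i. d (i + Suc m)\<bar> \<le> (1/3) ^ m / 2"
    using sums_unique[OF sg] by simp
  then show ?thesis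
    unfolding dist_real_def eq using dm by linarith
qed

text \<open>A least differing index \<open>m \<le> n\<close> would keep the codes at least
  \<open>(1/3) ^ m / 2\<close>, hence at least \<open>(1/3) ^ n / 2\<close>, apart.\<close>

lemma ternary_code_close:
  assumes "dist (ternary_code b) (ternary_code c) < (1/3) ^ n / 2" "i \<le> n"
  shows "b i = c i"
proof (rule ccontr)
  assume ne: "b i \<noteq> c i"
  define m where "m = (LEAST i. b i \<noteq> c i)"
  have m: "b m \<noteq> c m" "m \<le> i"
    unfolding m_def using ne by (rule LeastI, rule Least_le)
  have lt: "b k = c k" if "k < m" for k
    using not_less_Least[OF that[unfolded m_def]] by blast
  have "(1/3) ^ n / 2 \<le> (1/3::real) ^ m / 2"
    using m(2) assms(2) by (auto intro!: power_decreasing)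
  also have "\<dots> \<le> dist (ternary_code b) (ternary_code c)"
    by (rule ternary_code_dist[of m]) (use lt m(1) in auto)
  finally show False using assms(1) by simp
qed

text \<open>For each \<open>k\<close> a finite subset of \<open>Y\<close> provides the centres of
  balls of radius \<open>1 / Suc k\<close> that cover \<open>Y\<close>. The predicates are
  membership in these balls, over all \<open>k\<close> in one enumeration. Two points that agree on
  the balls of one cover lie in a common ball.\<close>

lemma compact_separating_predicates:
  fixes Y :: "'b::metric_space set"
  assumes "compact Y" "Y \<noteq> {}"
  obtains P :: "nat \<Rightarrow> 'b \<Rightarrow> bool" where
    "\<And>e. e > 0 \<Longrightarrow> \<exists>n. \<forall>x\<in>Y. \<forall>y\<in>Y. (\<forall>i\<le>n. P i x = P i y) \<longrightarrow> dist x y < e"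
proof -
  have "\<exists>F. F \<subseteq> Y \<and> finite F \<and> Y \<subseteq> (\<Union>c\<in>F. ball c (1 / Suc k))" for k
    by (rule compactE_image[OF assms(1), of Y "\<lambda>c. ball c (1 / Suc k)"]) auto
  then obtain F where F: "\<And>k. finite (F k)" "\<And>k. Y \<subseteq> (\<Union>c\<in>F k. ball c (1 / Suc k))"
    by metis
  define I where "I = Sigma UNIV F"
  have I: "countable I" unfolding I_def by (auto intro: countable_finite F)
  define P where "P i y \<longleftrightarrow> (case from_nat_into I i of (k, c) \<Rightarrow> y \<in> ball c (1 / Suc k))" for i y
  show thesis
  proof (rule that[of P])
    fix e :: real assume "e > 0"
    then obtain k where k: "2 / Suc k < e"
      using reals_Archimedean[of "e/2"] by (auto simp: field_simps)
    \<comment> \<open>Every ball of the \<open>k\<close>-th cover has index at most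
      \<open>n\<close>.\<close>
    define n where "n = Max ((\<lambda>c. to_nat_on I (k, c)) ` F k)"
    have "dist x y < e" if xy: "x \<in> Y" "y \<in> Y" "\<forall>i\<le>n. P i x = P i y" for x y
    proof -
      obtain c where c: "c \<in> F k" "x \<in> ball c (1 / Suc k)"
        using F(2) xy(1) by blast
      define i where "i = to_nat_on I (k, c)"
      have "i \<le> n" unfolding n_def i_def using c(1) F(1) by auto
      have "from_nat_into I i = (k, c)"
        unfolding i_def using c(1) I by (auto simp: I_def intro!: from_nat_into_to_nat_on)
      then have "y \<in> ball c (1 / Suc k)"
        using xy(3) \<open>i \<le> n\<close> c(2) by (auto simp: P_def)
      moreover have "dist x y \<le> dist c x + dist c y"
        by (rule dist_triangle3)
      ultimately have "dist x y < 1 / Suc k + 1 / Suc k"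
        using c(2) unfolding mem_ball by linarith
      then show ?thesis using k by simp
    qed
    then show "\<exists>n. \<forall>x\<in>Y. \<forall>y\<in>Y. (\<forall>i\<le>n. P i x = P i y) \<longrightarrow> dist x y < e"
      by blast
  qed
qed

text \<open>This brings questions of weak compactness on \<open>Y\<close> down to the real line,
  where Helly's theorem applies. The map sends a code to the point above it in the closed graph
  \<open>G\<close>.\<close>

lemma compact_image_of_compact_real:
  fixes Y :: "'b::metric_space set"
  assumes "compact Y" "Y \<noteq> {}"
  obtains K :: "real set" and \<phi> where "compact K" "continuous_on K \<phi>" "\<phi> ` K = Y"
proof -
  obtain P :: "nat \<Rightarrow> 'b \<Rightarrow> bool" where
    P: "\<And>e. e > 0 \<Longrightarrow> \<exists>n. \<forall>x\<in>Y. \<forall>y\<in>Y. (\<forall>i\<le>n. P i x = P i y) \<longrightarrow> dist x y < e"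
    using compact_separating_predicates[OF assms] by blast
  define \<psi> where "\<psi> y = ternary_code (\<lambda>i. P i y)" for y
  \<comment> \<open>\<open>\<psi>\<close> is injective but discontinuous. The closure of its graph is still the graph of an
    injective relation, because close codes share a long initial segment.\<close>
  define G where "G = closure ((\<lambda>y. (\<psi> y, y)) ` Y)"
  have "G \<subseteq> {0..2} \<times> Y"
    unfolding G_def
    by (rule closure_minimal)
      (auto simp: \<psi>_def ternary_code_in[simplified] intro!: closed_Times compact_imp_closed[OF assms(1)])
  have cG: "compact G"
  proof -
    have "compact (({0..2} \<times> Y) \<inter> G)"
      unfolding G_def by (intro compact_Int_closed compact_Times assms) auto
    with \<open>G \<subseteq> _\<close> show ?thesis by (simp add: Int_absorb1)
  qed
  have inj: "inj_on fst G"
  proof (rule inj_onI, clarsimp)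
    fix t y z assume G: "(t, y) \<in> G" "(t, z) \<in> G"
    show "y = z"
    proof (rule ccontr)
      assume "y \<noteq> z"
      \<comment> \<open>A third, because \<open>y\<close> and \<open>z\<close> will be joined
        through \<open>a\<close> and \<open>b\<close> by three distances, each below
        \<open>e\<close>.\<close>
      define e where "e = dist y z / 3"
      have e: "e > 0" using \<open>y \<noteq> z\<close> by (simp add: e_def)
      obtain n where n: "\<And>x y. x \<in> Y \<Longrightarrow> y \<in> Y \<Longrightarrow> (\<And>i. i \<le> n \<Longrightarrow> P i x = P i y) \<Longrightarrow> dist x y < e"
        using P[OF e] by metis
      \<comment> \<open>The quarter puts two codes within \<open>d\<close> of \<open>t\<close> at
        distance below \<open>(1/3) ^ n / 2\<close>, as \<open>ternary_code_close\<close>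
        demands.\<close>
      define d where "d = min e ((1/3) ^ n / 4)"
      have "d > 0" using e by (simp add: d_def)
      have approx: "\<exists>a\<in>Y. dist (\<psi> a) t < d \<and> dist a w < d" if w: "(t, w) \<in> G" for w
      proof -
        obtain a where "a \<in> Y" "dist (\<psi> a, a) (t, w) < d"
          using w \<open>d > 0\<close> unfolding G_def closure_approachable by blast
        then show ?thesis
          using dist_fst_le[of "(\<psi> a, a)" "(t, w)"] dist_snd_le[of "(\<psi> a, a)" "(t, w)"] by force
      qed
      from approx[OF G(1)] obtain a where a: "a \<in> Y" "dist (\<psi> a) t < d" "dist a y < d" by blast
      from approx[OF G(2)] obtain b where b: "b \<in> Y" "dist (\<psi> b) t < d" "dist b z < d" by blast
      have "dist (\<psi> a) (\<psi> b) < (1/3) ^ n / 2"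
        using dist_triangle2[of "\<psi> a" "\<psi> b" t] a(2) b(2) by (simp add: d_def)
      then have "dist a b < e"
        using a(1) b(1) ternary_code_close[of "\<lambda>i. P i a" "\<lambda>i. P i b" n]
        by (intro n) (auto simp: \<psi>_def)
      moreover have "dist y z \<le> dist a y + dist a b + dist b z"
        using dist_triangle[of y z a] dist_triangle[of a z b] by (simp add: dist_commute)
      ultimately show False using a(3) b(3) by (simp add: d_def e_def)
    qed
  qed
  define g where "g = inv_into G fst"
  show thesis
  proof (rule that[of "fst ` G" "snd \<circ> g"])
    show "compact (fst ` G)"
      by (intro compact_continuous_image continuous_intros cG)
    \<comment> \<open>A continuous injection on a compact set has a continuous inverse.\<close>
    have "continuous_on (fst ` G) g"
      by (rule continuous_on_inv) (auto simp: g_def inj cG intro!: continuous_intros)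
    then show "continuous_on (fst ` G) (snd \<circ> g)"
      by (auto simp: o_def intro!: continuous_intros)
    have "g ` fst ` G = G"
      using inj by (force simp: g_def image_iff)
    moreover have "snd ` G = Y"
      using \<open>G \<subseteq> _\<close> closure_subset[of "(\<lambda>y. (\<psi> y, y)) ` Y"] by (force simp: G_def)
    ultimately show "(snd \<circ> g) ` fst ` G = Y"
      by (simp only: image_comp[symmetric])
  qed
qed

section \<open>Weak limits of measures on compact metric spaces\<close>

text \<open>A common compact support makes the sequence tight, so Helly's theorem yields a weak
  limit. It is still carried by \<open>K\<close>, because a bounded continuous function that
  vanishes exactly on \<open>K\<close> keeps integral 0 in the limit.\<close>

lemma pmf_weak_limit_real:
  fixes p :: "nat \<Rightarrow> real pmf"
  assumes K: "compact K" and p: "\<And>n. set_pmf (p n) \<subseteq> K"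
  obtains r M where "strict_mono r" "real_distribution M" "AE t in M. t \<in> K"
    "\<And>(g :: real \<Rightarrow> real) c. continuous_on UNIV g \<Longrightarrow> (\<And>t. \<bar>g t\<bar> \<le> c) \<Longrightarrow>
      (\<lambda>n. measure_pmf.expectation (p (r n)) g) \<longlonglongrightarrow> integral\<^sup>L M g"
proof -
  define \<nu> where "\<nu> n = distr (measure_pmf (p n)) borel (\<lambda>t. t)" for n
  have \<nu>: "real_distribution (\<nu> n)" for n
    unfolding \<nu>_def by (rule prob_space.real_distribution_distr[OF prob_space_measure_pmf]) simp
  have E: "integral\<^sup>L (\<nu> n) g = measure_pmf.expectation (p n) g"
    if "g \<in> borel_measurable borel" for n and g :: "real \<Rightarrow> real"
    unfolding \<nu>_def using that by (subst integral_distr) auto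
  obtain a where a: "\<And>t. t \<in> K \<Longrightarrow> \<bar>t\<bar> \<le> a"
    using compact_imp_bounded[OF K] by (auto simp: bounded_iff)
  \<comment> \<open>The extra 1 compensates for the interval being open on the left, and also keeps
    it nonempty when \<open>a = 0\<close>.\<close>
  have "measure (\<nu> n) {- \<bar>a\<bar> - 1 <.. \<bar>a\<bar>} = 1" for n
  proof -
    have "set_pmf (p n) \<subseteq> {- \<bar>a\<bar> - 1 <.. \<bar>a\<bar>}"
      using p[of n] a by fastforce
    then have "measure_pmf.prob (p n) {- \<bar>a\<bar> - 1 <.. \<bar>a\<bar>} = 1"
      by (subst measure_pmf.prob_eq_1) (auto simp: AE_measure_pmf_iff)
    then show ?thesis unfolding \<nu>_def by (subst measure_distr) auto
  qed
  then have "\<exists>a b. a < b \<and> (\<forall>n. 1 - e < measure (\<nu> n) {a<..b})" if "e > 0" for e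
    using that by (intro exI[of _ "- \<bar>a\<bar> - 1"] exI[of _ "\<bar>a\<bar>"]) auto
  then have "tight \<nu>"
    unfolding tight_def using \<nu> by blast
  then obtain r M where rM: "strict_mono r" "real_distribution M" "weak_conv_m (\<nu> \<circ> id \<circ> r) M"
    using tight_imp_convergent_subsubsequence[of \<nu> id] strict_mono_id by blast
  interpret M: real_distribution M by (rule rM(2))
  have conv: "(\<lambda>n. measure_pmf.expectation (p (r n)) g) \<longlonglongrightarrow> integral\<^sup>L M g"
    if g: "continuous_on UNIV g" "\<And>t. \<bar>g t\<bar> \<le> c" for g :: "real \<Rightarrow> real" and c
  proof -
    have "(\<lambda>n. integral\<^sup>L ((\<nu> \<circ> id \<circ> r) n) g) \<longlonglongrightarrow> integral\<^sup>L M g"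
      by (rule weak_conv_imp_integral_bdd_continuous_conv[of _ M g c])
        (use \<nu> rM g in \<open>auto simp: continuous_on_eq_continuous_at o_def\<close>)
    then show ?thesis
      using g(1) by (simp add: E borel_measurable_continuous_onI)
  qed
  have "AE t in M. t \<in> K"
  proof -
    have ne: "K \<noteq> {}" using p[of 0] set_pmf_not_empty[of "p 0"] by auto
    \<comment> \<open>The truncation at 1 makes the distance to \<open>K\<close> an admissible
      bounded test function without changing its zero set.\<close>
    define h where "h t = min 1 (infdist t K)" for t :: real
    have h: "continuous_on UNIV h" "\<bar>h t\<bar> \<le> 1" "0 \<le> h t" for t
      unfolding h_def by (auto intro!: continuous_intros simp: infdist_nonneg abs_le_iff)
    have "measure_pmf.expectation (p n) h = 0" for n
      by (rule integral_eq_zero_AE) (use p[of n] in \<open>auto simp: AE_measure_pmf_iff h_def subset_eq\<close>)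
    then have "integral\<^sup>L M h = 0"
      using LIMSEQ_unique[OF conv[OF h(1,2)]] by simp
    moreover have "integrable M h"
      by (rule M.integrable_const_bound[of _ 1])
        (use h in \<open>auto simp: borel_measurable_continuous_onI\<close>)
    ultimately have "AE t in M. h t = 0"
      using integral_nonneg_eq_0_iff_AE[of M h] h(3) by simp
    moreover have "t \<in> K" if "h t = 0" for t
    proof -
      have "infdist t K = 0" using that by (simp add: h_def min_def split: if_splits)
      then show ?thesis
        using in_closed_iff_infdist_zero[OF compact_imp_closed[OF K] ne] by blast
    qed
    ultimately show ?thesis by (auto elim!: eventually_mono)
  qed
  with rM conv show thesis by (intro that[of r M]) auto
qed

text \<open>The distributions are lifted to \<open>K\<close> through a right inverse of \<phi>, a
  weak limit is taken on the line, and the limit is pushed forward by \<phi>.\<close>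

lemma pmf_weak_limit:
  fixes Y :: "'b::metric_space set" and p :: "nat \<Rightarrow> 'b pmf"
  assumes Y: "compact Y" and p: "\<And>n. set_pmf (p n) \<subseteq> Y"
  obtains r M where "strict_mono r" "prob_space M" "sets M = sets (restrict_space borel Y)"
    "\<And>g :: 'b \<Rightarrow> real. continuous_on Y g \<Longrightarrow>
      (\<lambda>n. measure_pmf.expectation (p (r n)) g) \<longlonglongrightarrow> integral\<^sup>L M g"
proof -
  have ne: "Y \<noteq> {}" using p[of 0] set_pmf_not_empty[of "p 0"] by auto
  obtain K :: "real set" and \<phi> where K: "compact K" "continuous_on K \<phi>" "\<phi> ` K = Y"
    using compact_image_of_compact_real[OF Y ne] by blast
  then obtain y0 where y0: "y0 \<in> Y" using ne by blast
  \<comment> \<open>An arbitrary choice of preimages is harmless: it is applied only to discrete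
    distributions, where measurability is automatic.\<close>
  define \<psi> where "\<psi> = inv_into K \<phi>"
  have \<psi>: "\<psi> y \<in> K" "\<phi> (\<psi> y) = y" if "y \<in> Y" for y
    using that K(3) unfolding \<psi>_def by (auto intro: inv_into_into f_inv_into_f)
  have q: "set_pmf (map_pmf \<psi> (p n)) \<subseteq> K" for n
    using p[of n] \<psi> by auto
  have clK: "closed K" by (rule compact_imp_closed[OF K(1)])
  obtain r N where rN: "strict_mono r" "real_distribution N" "AE t in N. t \<in> K"
    "\<And>(g :: real \<Rightarrow> real) B. continuous_on UNIV g \<Longrightarrow> (\<And>t. \<bar>g t\<bar> \<le> B) \<Longrightarrow>
      (\<lambda>n. measure_pmf.expectation (map_pmf \<psi> (p (r n))) g) \<longlonglongrightarrow> integral\<^sup>L N g"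
    by (rule pmf_weak_limit_real[of K "\<lambda>n. map_pmf \<psi> (p n)", OF K(1) q]) blast
  interpret N: real_distribution N by (rule rN(2))
  \<comment> \<open>The default value \<open>y0\<close> keeps the range inside \<open>Y\<close>; it
    is taken only on the complement of \<open>K\<close>, which is null for \<open>N\<close>.\<close>
  define \<phi>' where "\<phi>' t = (if t \<in> K then \<phi> t else y0)" for t
  have "\<phi>' \<in> borel_measurable borel"
    unfolding \<phi>'_def using clK K(2) by (intro borel_measurable_continuous_on_if) auto
  then have \<phi>'[measurable]: "\<phi>' \<in> measurable N (restrict_space borel Y)"
    by (intro measurable_restrict_space2) (use K(3) y0 in \<open>auto simp: \<phi>'_def\<close>)
  define M where "M = distr N (restrict_space borel Y) \<phi>'"
  show thesis
  proof (rule that[of r M])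
    show "prob_space M" unfolding M_def by (rule N.prob_space_distr[OF \<phi>'])
    show "sets M = sets (restrict_space borel Y)" by (simp add: M_def)
    fix g :: "'b \<Rightarrow> real" assume g: "continuous_on Y g"
    have "compact (g ` Y)" by (rule compact_continuous_image[OF g Y])
    then obtain B where B: "\<And>y. y \<in> Y \<Longrightarrow> norm (g y) \<le> B"
      using compact_imp_bounded by (force simp: bounded_iff)
    have "B \<ge> 0" using B[OF y0] norm_ge_zero order_trans by blast
    \<comment> \<open>Tietze's theorem extends the pulled-back function to the whole line with the
      same bound, as weak convergence on the line requires.\<close>
    obtain G :: "real \<Rightarrow> real" where G: "continuous_on UNIV G" "\<And>t. t \<in> K \<Longrightarrow> G t = g (\<phi> t)"
        "\<And>t. norm (G t) \<le> B"
      by (rule Tietze[of K "\<lambda>t. g (\<phi> t)" UNIV B])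
        (use clK K g B \<open>B \<ge> 0\<close> in \<open>auto intro!: continuous_on_compose2[OF g]\<close>)
    have [measurable]: "g \<in> borel_measurable (restrict_space borel Y)"
      by (rule borel_measurable_continuous_on_restrict[OF g])
    have [measurable]: "G \<in> borel_measurable borel"
      by (rule borel_measurable_continuous_onI[OF G(1)])
    have "integral\<^sup>L M g = (\<integral>t. g (\<phi>' t) \<partial>N)"
      unfolding M_def by (subst integral_distr) auto
    also have "\<dots> = integral\<^sup>L N G"
    proof (rule integral_cong_AE)
      show "AE t in N. g (\<phi>' t) = G t"
        using rN(3) G(2) by (auto simp: \<phi>'_def elim!: eventually_mono)
    qed measurable
    finally have "integral\<^sup>L M g = integral\<^sup>L N G" .
    moreover have "measure_pmf.expectation (map_pmf \<psi> (p n)) G = measure_pmf.expectation (p n) g" for n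
      unfolding integral_map_pmf
      by (rule integral_cong_AE) (use p[of n] \<psi> G(2) in \<open>auto simp: AE_measure_pmf_iff subset_eq\<close>)
    ultimately show "(\<lambda>n. measure_pmf.expectation (p (r n)) g) \<longlonglongrightarrow> integral\<^sup>L M g"
      using rN(4)[OF G(1), of B] G(3) by simp
  qed (rule rN(1))
qed

section \<open>Measures on a closed set are determined by integrals of continuous functions\<close>

lemma sets_restrict_borel_closed:
  assumes "closed Y"
  shows "sets (restrict_space borel Y) = sigma_sets Y {C. closed C \<and> C \<subseteq> Y}"
proof -
  have "sets (restrict_space borel Y) = (\<inter>) Y ` sigma_sets UNIV (Collect closed)"
    by (simp add: sets_restrict_space borel_eq_closed)
  also have "\<dots> = sigma_sets Y ((\<inter>) Y ` Collect closed)"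
    by (rule sigma_sets_Int) (use assms in \<open>auto intro: sigma_sets.Basic\<close>)
  also have "(\<inter>) Y ` Collect closed = {C. closed C \<and> C \<subseteq> Y}"
    using assms by auto
  finally show ?thesis .
qed

text \<open>The indicator of a closed set is a pointwise limit of continuous functions with values
  in [0,1]. By dominated convergence the integrals fix the measure of closed subsets of
  \<open>Y\<close>, and these form a generator stable under intersection.\<close>

lemma measure_eqI_continuous_integrals:
  fixes Y :: "'b::metric_space set"
  assumes Y: "closed Y" and fin: "finite_measure M" "finite_measure N"
    and sets: "sets M = sets (restrict_space borel Y)" "sets N = sets (restrict_space borel Y)"
    and eq: "\<And>g :: 'b \<Rightarrow> real. continuous_on Y g \<Longrightarrow> integral\<^sup>L M g = integral\<^sup>L N g"
  shows "M = N"
proof -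
  interpret M: finite_measure M by fact
  interpret N: finite_measure N by fact
  \<comment> \<open>Equal to 1 on \<open>C\<close>, decreasing with slope \<open>n\<close> in the
    distance from \<open>C\<close>, and 0 from distance \<open>1 / n\<close> on when
    \<open>n > 0\<close>.\<close>
  define h where "h C n x = max 0 (1 - real n * infdist x C)" for C n and x :: 'b
  have lim: "(\<lambda>n. integral\<^sup>L L (h C n)) \<longlonglongrightarrow> measure L C"
    if L: "finite_measure L" "sets L = sets (restrict_space borel Y)"
      and C: "closed C" "C \<noteq> {}" "C \<subseteq> Y" for L C
  proof -
    interpret L: finite_measure L by fact
    have meas: "h C n \<in> borel_measurable L" for n
      unfolding measurable_cong_sets[OF L(2) refl] h_def
      by (intro borel_measurable_continuous_on_restrict continuous_intros)
    have C': "C \<in> sets L" 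
      unfolding L(2) sets_restrict_borel_closed[OF Y] using C by (auto intro: sigma_sets.Basic)
    have ptw: "(\<lambda>n. h C n x) \<longlonglongrightarrow> indicator C x" for x
    proof (cases "x \<in> C")
      case True
      then show ?thesis by (simp add: h_def)
    next
      case False
      then have pos: "infdist x C > 0"
        using in_closed_iff_infdist_zero[OF C(1,2), of x] infdist_nonneg[of x C] by linarith
      obtain m :: nat where m: "1 / infdist x C < m" using reals_Archimedean2 by blast
      have "h C n x = 0" if "n \<ge> m" for n
      proof -
        have "1 / infdist x C < n" using m that by linarith
        then show ?thesis using pos by (simp add: h_def field_simps)
      qed
      then have "eventually (\<lambda>n. h C n x = indicator C x) sequentially"
        using False by (auto simp: eventually_sequentially)
      then show ?thesis by (rule tendsto_eventually)
    qed
    have "(\<lambda>n. integral\<^sup>L L (h C n)) \<longlonglongrightarrow> integral\<^sup>L L (indicator C)"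
      by (rule integral_dominated_convergence[of _ _ _ "\<lambda>_. 1"])
        (use meas ptw C' in \<open>auto simp: h_def infdist_nonneg\<close>)
    moreover have "integral\<^sup>L L (indicator C) = measure L C"
      using C' by simp
    ultimately show ?thesis by simp
  qed
  have "measure M C = measure N C" if C: "closed C" "C \<subseteq> Y" for C
  \<comment> \<open>\<open>infdist\<close> to the empty set is 0 by convention, so
    \<open>h {} n\<close> is constantly 1 and does not approximate the indicator.\<close>
  proof (cases "C = {}")
    case False
    have "continuous_on Y (h C n)" for n
      unfolding h_def by (intro continuous_intros)
    then have "integral\<^sup>L M (h C n) = integral\<^sup>L N (h C n)" for n
      by (rule eq)
    then show ?thesis
      using LIMSEQ_unique[OF lim[OF fin(1) sets(1) C(1) False C(2)]]
        lim[OF fin(2) sets(2) C(1) False C(2)] by simp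
  qed simp
  then show ?thesis
    by (intro measure_eqI_generator_eq[of "{C. closed C \<and> C \<subseteq> Y}" Y M N "\<lambda>_. Y"])
      (use Y in \<open>auto simp: Int_stable_def sets sets_restrict_borel_closed
         M.emeasure_eq_measure N.emeasure_eq_measure\<close>)
qed

section \<open>Abel means over uniquely ergodic systems\<close>

text \<open>For \<open>0 < s < 1\<close> the weights \<open>(1 - s) * s ^ j\<close> are those of a
  geometric distribution, so this is an average of \<open>a\<close>.\<close>

definition abel_mean :: "real \<Rightarrow> (nat \<Rightarrow> 'c::real_normed_vector) \<Rightarrow> 'c" where
  "abel_mean s a = (1 - s) *\<^sub>R (\<Sum>j. s ^ j *\<^sub>R a j)"

context
  fixes s B :: real and a :: "nat \<Rightarrow> 'c::{banach, second_countable_topology}"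
  assumes s: "0 < s" "s < 1" and B: "\<And>j. norm (a j) \<le> B"
begin

lemma sums_geometric_bound: "(\<lambda>j. s ^ j * B) sums (B / (1 - s))"
  using sums_mult2[OF geometric_sums[of s], of B] s by simp

lemma norm_abel_term_le: "norm (s ^ j *\<^sub>R a j) \<le> s ^ j * B"
  using s B[of j] by (auto intro!: mult_left_mono)

lemma summable_abel: "summable (\<lambda>j. s ^ j *\<^sub>R a j)"
  by (rule summable_comparison_test'[OF sums_summable[OF sums_geometric_bound] norm_abel_term_le])

lemma norm_abel_mean_le: "norm (abel_mean s a) \<le> B"
proof -
  have "norm (\<Sum>j. s ^ j *\<^sub>R a j) \<le> B / (1 - s)"
    using norm_suminf_le[OF norm_abel_term_le sums_summable[OF sums_geometric_bound]]
      sums_unique[OF sums_geometric_bound] by simp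
  then show ?thesis
    using s by (simp add: abel_mean_def pos_le_divide_eq mult.commute)
qed

text \<open>Shifting the sequence changes the mean only by a term of order \<open>1 - s\<close>.
  This makes weak limits invariant as \<open>s\<close> tends to 1, and it also yields the recurrence
  for exponential means.\<close>

lemma abel_mean_Suc: "abel_mean s a = (1 - s) *\<^sub>R a 0 + s *\<^sub>R abel_mean s (\<lambda>j. a (Suc j))"
proof -
  have "summable (\<lambda>j. s ^ j *\<^sub>R a (Suc j))"
    by (rule summable_comparison_test'[OF sums_summable[OF sums_geometric_bound]])
      (use s B in \<open>auto intro!: mult_left_mono\<close>)
  then have "(\<Sum>j. s ^ Suc j *\<^sub>R a (Suc j)) = s *\<^sub>R (\<Sum>j. s ^ j *\<^sub>R a (Suc j))"
    using suminf_scaleR_right[of "\<lambda>j. s ^ j *\<^sub>R a (Suc j)" s] by simp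
  then have "(\<Sum>j. s ^ j *\<^sub>R a j) = a 0 + s *\<^sub>R (\<Sum>j. s ^ j *\<^sub>R a (Suc j))"
    using suminf_split_head[OF summable_abel] by (simp add: algebra_simps)
  then show ?thesis
    by (simp add: abel_mean_def scaleR_add_right mult.commute)
qed

lemma bounded_linear_abel_mean:
  "bounded_linear f \<Longrightarrow> f (abel_mean s a) = abel_mean s (\<lambda>j. f (a j))"
  unfolding abel_mean_def
  by (simp add: bounded_linear.suminf[OF _ summable_abel] linear_simps)

text \<open>Reading the mean as an expectation is what allows weak limits of distributions to be
  applied to it.\<close>

lemma expectation_geometric_pmf_eq_abel_mean:
  "measure_pmf.expectation (geometric_pmf (1 - s)) a = abel_mean s a"
proof -
  have "0 < 1 - s" "1 - s \<le> 1" using s by auto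
  note [simp] = pmf_geometric[OF this]
  have "summable (\<lambda>j. norm ((s ^ j * (1 - s)) *\<^sub>R a j))"
  proof (rule summable_comparison_test')
    show "summable (\<lambda>j. s ^ j * B)" using sums_geometric_bound by (rule sums_summable)
    fix n
    have "s ^ n * (1 - s) * norm (a n) \<le> s ^ n * norm (a n)"
      using s by (intro mult_right_mono) (auto simp: mult_left_le)
    then show "norm (norm ((s ^ n * (1 - s)) *\<^sub>R a n)) \<le> s ^ n * B"
      using norm_abel_term_le[of n] s by (simp add: abs_mult)
  qed
  then have int: "integrable (count_space UNIV) (\<lambda>j. (s ^ j * (1 - s)) *\<^sub>R a j)"
    by (subst integrable_count_space_nat_iff)
  have "measure_pmf.expectation (geometric_pmf (1 - s)) a
      = (\<integral>j. (s ^ j * (1 - s)) *\<^sub>R a j \<partial>count_space UNIV)"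
    unfolding measure_pmf_eq_density using s by (subst integral_density) auto
  also have "\<dots> = (\<Sum>j. (s ^ j * (1 - s)) *\<^sub>R a j)"
    by (rule integral_count_space_nat[OF int])
  also have "\<dots> = (\<Sum>j. (1 - s) *\<^sub>R (s ^ j *\<^sub>R a j))"
    by (simp add: mult.commute)
  also have "\<dots> = abel_mean s a"
    unfolding abel_mean_def by (rule suminf_scaleR_right[OF summable_abel, symmetric])
  finally show ?thesis .
qed

end

lemma funpow_in:
  assumes "F ` Y \<subseteq> Y" "y \<in> Y"
  shows "(F ^^ j) y \<in> Y"
  using assms by (induction j) auto

lemma continuous_on_funpow:
  assumes "continuous_on Y F" "F ` Y \<subseteq> Y"
  shows "continuous_on Y (F ^^ j)"
proof (induction j)
  case (Suc j)
  have "(F ^^ j) ` Y \<subseteq> Y" using funpow_in[OF assms(2)] by auto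
  with Suc show ?case
    by (auto intro!: continuous_on_compose2[OF assms(1)])
qed simp

lemma continuous_compact_norm_bound:
  fixes g :: "'b::topological_space \<Rightarrow> 'c::real_normed_vector"
  assumes "continuous_on Y g" "compact Y"
  obtains B where "0 \<le> B" "\<And>y. y \<in> Y \<Longrightarrow> norm (g y) \<le> B"
proof -
  obtain B where "B > 0" "\<And>y. y \<in> Y \<Longrightarrow> norm (g y) \<le> B"
    using compact_imp_bounded[OF compact_continuous_image[OF assms]] by (force simp: bounded_pos)
  then show thesis by (intro that[of B]) auto
qed

text \<open>If uniformity failed, there would be parameters tending to 1 and starting points whose
  means stay \<open>e\<close> away from the integral of \<open>g\<close>. A weak limit of the
  corresponding orbit distributions is invariant, hence equal to \<mu>, and this contradicts the
  gap.\<close>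

lemma uniquely_ergodic_abel_mean_real:
  fixes Y :: "'b::metric_space set" and g :: "'b \<Rightarrow> real"
  assumes Y: "compact Y" and ue: "uniquely_ergodic Y F"
    and F: "continuous_on Y F" "F ` Y \<subseteq> Y" and g: "continuous_on Y g"
  shows "\<exists>c. uniform_limit Y (\<lambda>s y. abel_mean s (\<lambda>j. g ((F ^^ j) y))) (\<lambda>_. c) (at_left 1)"
proof -
  obtain \<mu> where \<mu>: "\<And>M. invariant_prob Y F M \<Longrightarrow> M = \<mu>"
    using ue unfolding uniquely_ergodic_def by blast
  have "uniform_limit Y (\<lambda>s y. abel_mean s (\<lambda>j. g ((F ^^ j) y))) (\<lambda>_. integral\<^sup>L \<mu> g) (at_left 1)"
  proof (rule ccontr)
    assume "\<not> ?thesis"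
    then obtain e where e: "e > 0" and "\<not> (\<forall>\<^sub>F s in at_left 1. \<forall>y\<in>Y.
        dist (abel_mean s (\<lambda>j. g ((F ^^ j) y))) (integral\<^sup>L \<mu> g) < e)"
      unfolding uniform_limit_iff by blast
    then have "\<forall>b<1. \<exists>s y. b < s \<and> s < 1 \<and> y \<in> Y \<and>
        e \<le> dist (abel_mean s (\<lambda>j. g ((F ^^ j) y))) (integral\<^sup>L \<mu> g)"
      by (subst (asm) eventually_at_left[of 0]) (auto simp: not_less, metis not_le)
    \<comment> \<open>These lower bounds are positive and tend to 1, so the chosen parameters are
      positive and tend to 1 as well.\<close>
    then have "\<forall>n. \<exists>s y. 1 - 1 / real (n + 2) < s \<and> s < 1 \<and> y \<in> Y \<and>
        e \<le> dist (abel_mean s (\<lambda>j. g ((F ^^ j) y))) (integral\<^sup>L \<mu> g)"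
      by simp
    then obtain s y where sy: "\<And>n. 1 - 1 / real (n + 2) < s n" "\<And>n. s n < 1" "\<And>n. y n \<in> Y"
        "\<And>n. e \<le> dist (abel_mean (s n) (\<lambda>j. g ((F ^^ j) (y n)))) (integral\<^sup>L \<mu> g)"
      by metis
    have s0: "0 < s n" for n
    proof -
      have "1 / real (n + 2) \<le> 1" by simp
      with sy(1)[of n] show ?thesis by linarith
    qed
    have s1: "(\<lambda>n. 1 - s n) \<longlonglongrightarrow> 0"
    proof (rule tendsto_sandwich[of "\<lambda>_. 0"])
      show "(\<lambda>n. 1 / real (n + 2)) \<longlonglongrightarrow> 0"
        using LIMSEQ_ignore_initial_segment[OF lim_inverse_n', of 2] by simp
      show "\<forall>\<^sub>F n in sequentially. 1 - s n \<le> 1 / real (n + 2)"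
        using sy(1) by (intro always_eventually) (simp add: algebra_simps less_imp_le)
    qed (use sy(2) in \<open>auto intro!: always_eventually less_imp_le\<close>)
    \<comment> \<open>The law of the point reached from \<open>y n\<close> after a geometrically
      distributed number of steps.\<close>
    define p where "p n = map_pmf (\<lambda>j. (F ^^ j) (y n)) (geometric_pmf (1 - s n))" for n
    have p: "set_pmf (p n) \<subseteq> Y" for n
      unfolding p_def using funpow_in[OF F(2) sy(3)] by auto
    have E: "measure_pmf.expectation (p n) h = abel_mean (s n) (\<lambda>j. h ((F ^^ j) (y n)))"
      if h: "continuous_on Y h" for h :: "'b \<Rightarrow> real" and n
    proof -
      obtain B where "0 \<le> B" and B: "\<And>y. y \<in> Y \<Longrightarrow> norm (h y) \<le> B"
        using continuous_compact_norm_bound[OF h Y] by blast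
      show ?thesis
        unfolding p_def integral_map_pmf
        by (rule expectation_geometric_pmf_eq_abel_mean[of _ _ B])
          (use B funpow_in[OF F(2) sy(3)] s0 sy(2) in auto)
    qed
    obtain r M where rM: "strict_mono r" "prob_space M" "sets M = sets (restrict_space borel Y)"
      "\<And>h :: 'b \<Rightarrow> real. continuous_on Y h \<Longrightarrow>
        (\<lambda>n. measure_pmf.expectation (p (r n)) h) \<longlonglongrightarrow> integral\<^sup>L M h"
      by (rule pmf_weak_limit[of Y p, OF Y p]) blast
    interpret M: prob_space M by (rule rM(2))
    have FM: "F \<in> measurable M M"
      unfolding measurable_cong_sets[OF rM(3) rM(3)]
      using F by (intro measurable_restrict_space2 borel_measurable_continuous_on_restrict)
        (auto simp: space_restrict_space)
    have inv: "(\<integral>x. h (F x) \<partial>M) = integral\<^sup>L M h" if h: "continuous_on Y h" for h :: "'b \<Rightarrow> real"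
    proof -
      have hF: "continuous_on Y (\<lambda>x. h (F x))"
        by (rule continuous_on_compose2[OF h F])
      obtain B where B: "0 \<le> B" "\<And>y. y \<in> Y \<Longrightarrow> norm (h y) \<le> B"
        using continuous_compact_norm_bound[OF h Y] by blast
      have bd: "norm (h ((F ^^ j) (y n))) \<le> B" for j n
        using B(2) funpow_in[OF F(2) sy(3)] by blast
      \<comment> \<open>Composing \<open>h\<close> with \<open>F\<close> shifts the orbit by one
        step, which costs at most \<open>(1 - s n) * (2 * B)\<close>.\<close>
      have d: "\<bar>measure_pmf.expectation (p n) h - measure_pmf.expectation (p n) (\<lambda>x. h (F x))\<bar>
          \<le> (1 - s n) * (2 * B)" for n
      proof -
        define A where "A = abel_mean (s n) (\<lambda>j. h ((F ^^ Suc j) (y n)))"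
        have "norm A \<le> B"
          unfolding A_def by (rule norm_abel_mean_le[OF s0 sy(2) bd])
        moreover have "norm (h (y n)) \<le> B" using B(2) sy(3) by blast
        ultimately have le: "\<bar>h (y n) - A\<bar> \<le> 2 * B"
          unfolding real_norm_def by linarith
        have "measure_pmf.expectation (p n) h = (1 - s n) * h (y n) + s n * A"
          using abel_mean_Suc[OF s0 sy(2) bd[of _ n]] by (simp add: E[OF h] A_def)
        moreover have "measure_pmf.expectation (p n) (\<lambda>x. h (F x)) = A"
          by (simp add: E[OF hF] A_def)
        ultimately have "measure_pmf.expectation (p n) h
            - measure_pmf.expectation (p n) (\<lambda>x. h (F x)) = (1 - s n) * (h (y n) - A)"
          by (simp add: algebra_simps)
        then show ?thesis
          using sy(2)[of n] le by (simp add: abs_mult mult_left_mono)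
      qed
      have "(\<lambda>n. measure_pmf.expectation (p n) h - measure_pmf.expectation (p n) (\<lambda>x. h (F x))) \<longlonglongrightarrow> 0"
        by (rule Lim_null_comparison[OF _ tendsto_mult_left_zero[OF s1, of "2 * B"]])
          (use d in \<open>auto intro!: always_eventually\<close>)
      from LIMSEQ_subseq_LIMSEQ[OF this rM(1)]
      have "(\<lambda>n. measure_pmf.expectation (p (r n)) h - measure_pmf.expectation (p (r n)) (\<lambda>x. h (F x))) \<longlonglongrightarrow> 0"
        by (simp add: o_def)
      moreover have "(\<lambda>n. measure_pmf.expectation (p (r n)) h - measure_pmf.expectation (p (r n)) (\<lambda>x. h (F x)))
          \<longlonglongrightarrow> integral\<^sup>L M h - (\<integral>x. h (F x) \<partial>M)"
        by (intro tendsto_diff rM(4) h hF)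
      ultimately show ?thesis using LIMSEQ_unique by fastforce
    qed
    have "distr M M F = M"
    proof (rule measure_eqI_continuous_integrals[OF compact_imp_closed[OF Y]])
      show "finite_measure (distr M M F)"
        using M.prob_space_distr[OF FM] by (simp add: prob_space_def)
      show "integral\<^sup>L (distr M M F) h = integral\<^sup>L M h" if h: "continuous_on Y h" for h :: "'b \<Rightarrow> real"
      proof -
        have "h \<in> borel_measurable M"
          unfolding measurable_cong_sets[OF rM(3) refl]
          by (rule borel_measurable_continuous_on_restrict[OF h])
        then show ?thesis using inv[OF h] FM by (simp add: integral_distr)
      qed
    qed (simp_all add: rM(3) M.finite_measure_axioms)
    then have "M = \<mu>"
      using \<mu> FM rM(2,3) by (simp add: invariant_prob_def)
    then have "(\<lambda>n. abel_mean (s (r n)) (\<lambda>j. g ((F ^^ j) (y (r n))))) \<longlonglongrightarrow> integral\<^sup>L \<mu> g"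
      using rM(4)[OF g] by (simp add: E[OF g])
    then have "\<forall>\<^sub>F n in sequentially.
        dist (abel_mean (s (r n)) (\<lambda>j. g ((F ^^ j) (y (r n))))) (integral\<^sup>L \<mu> g) < e"
      using e by (rule tendstoD)
    then obtain n where
        "dist (abel_mean (s (r n)) (\<lambda>j. g ((F ^^ j) (y (r n))))) (integral\<^sup>L \<mu> g) < e"
      using eventually_happens'[OF sequentially_bot] by blast
    with sy(4)[of "r n"] show False by simp
  qed
  then show ?thesis by blast
qed

lemma uniform_limit_sum:
  fixes f :: "'i \<Rightarrow> 's \<Rightarrow> 'x \<Rightarrow> 'c::real_normed_vector"
  assumes "\<And>i. i \<in> I \<Longrightarrow> uniform_limit X (f i) (l i) G"
  shows "uniform_limit X (\<lambda>s x. \<Sum>i\<in>I. f i s x) (\<lambda>x. \<Sum>i\<in>I. l i x) G"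
  using assms
  by (induction I rule: infinite_finite_induct) (auto intro!: uniform_limit_intros)

text \<open>The real case is applied to each coordinate, and the finitely many uniform limits are
  recombined along the basis.\<close>

lemma uniquely_ergodic_abel_mean:
  fixes Y :: "'b::metric_space set" and g :: "'b \<Rightarrow> 'c::euclidean_space"
  assumes Y: "compact Y" and ue: "uniquely_ergodic Y F"
    and F: "continuous_on Y F" "F ` Y \<subseteq> Y" and g: "continuous_on Y g"
  shows "\<exists>c. uniform_limit Y (\<lambda>s y. abel_mean s (\<lambda>j. g ((F ^^ j) y))) (\<lambda>_. c) (at_left 1)"
proof -
  have "\<exists>c. uniform_limit Y (\<lambda>s y. abel_mean s (\<lambda>j. g ((F ^^ j) y) \<bullet> b)) (\<lambda>_. c) (at_left 1)" for b
    by (rule uniquely_ergodic_abel_mean_real[OF Y ue F]) (intro continuous_intros g)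
  then obtain c where c: "\<And>b. uniform_limit Y
      (\<lambda>s y. abel_mean s (\<lambda>j. g ((F ^^ j) y) \<bullet> b)) (\<lambda>_. c b) (at_left 1)"
    by metis
  obtain B where "0 \<le> B" and B: "\<And>y. y \<in> Y \<Longrightarrow> norm (g y) \<le> B"
    using continuous_compact_norm_bound[OF g Y] by blast
  have eq: "(\<Sum>b\<in>Basis. abel_mean s (\<lambda>j. g ((F ^^ j) y) \<bullet> b) *\<^sub>R b) = abel_mean s (\<lambda>j. g ((F ^^ j) y))"
    if "y \<in> Y" "0 < s" "s < 1" for s y
  proof -
    have "abel_mean s (\<lambda>j. g ((F ^^ j) y)) \<bullet> b = abel_mean s (\<lambda>j. g ((F ^^ j) y) \<bullet> b)" for b
      by (rule bounded_linear_abel_mean[of _ _ B])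
        (use that B funpow_in[OF F(2)] bounded_linear_inner_left in auto)
    then show ?thesis
      using euclidean_representation[of "abel_mean s (\<lambda>j. g ((F ^^ j) y))"] by simp
  qed
  have "uniform_limit Y (\<lambda>s y. \<Sum>b\<in>Basis. abel_mean s (\<lambda>j. g ((F ^^ j) y) \<bullet> b) *\<^sub>R b)
      (\<lambda>_. \<Sum>b\<in>Basis. c b *\<^sub>R b) (at_left 1)"
    by (intro uniform_limit_sum bounded_linear.uniform_limit[OF bounded_linear_scaleR_left] c)
  then have "uniform_limit Y (\<lambda>s y. abel_mean s (\<lambda>j. g ((F ^^ j) y)))
      (\<lambda>_. \<Sum>b\<in>Basis. c b *\<^sub>R b) (at_left 1)"
    by (rule uniform_limit_cong[THEN iffD1, rotated 2])
      (use eq in \<open>auto simp: eventually_at_left[of 0] intro!: exI[of _ 0]\<close>)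
  then show ?thesis by blast
qed

section \<open>Orthogonal cocycles\<close>

lemma continuous_on_matrix_mult [continuous_intros]:
  fixes f :: "'b::topological_space \<Rightarrow> real^'n^'m" and g :: "'b \<Rightarrow> real^'k^'n"
  shows "continuous_on S f \<Longrightarrow> continuous_on S g \<Longrightarrow> continuous_on S (\<lambda>x. f x ** g x)"
  unfolding matrix_matrix_mult_def by (intro continuous_intros)

lemma continuous_on_matrix_vector_mult [continuous_intros]:
  fixes f :: "'b::topological_space \<Rightarrow> real^'n^'m" and g :: "'b \<Rightarrow> real^'n"
  shows "continuous_on S f \<Longrightarrow> continuous_on S g \<Longrightarrow> continuous_on S (\<lambda>x. f x *v g x)"
  unfolding matrix_vector_mult_def by (intro continuous_intros)

lemma continuous_on_transpose [continuous_intros]: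
  fixes f :: "'b::topological_space \<Rightarrow> real^'n^'m"
  shows "continuous_on S f \<Longrightarrow> continuous_on S (\<lambda>x. transpose (f x))"
  unfolding transpose_def by (intro continuous_intros)

text \<open>\<open>matrix_inv\<close> is defined by choice; the transpose is a two-sided inverse,
  and inverses are unique. In this form continuity and orthogonality of the inverse are
  evident.\<close>

lemma matrix_inv_orthogonal:
  fixes A :: "real^'n^'n"
  assumes "A \<in> orthogonal_group"
  shows "matrix_inv A = transpose A"
proof -
  have A: "A ** transpose A = mat 1" "transpose A ** A = mat 1"
    using assms by (auto simp: orthogonal_group_def orthogonal_matrix_def)
  then have "A ** matrix_inv A = mat 1 \<and> matrix_inv A ** A = mat 1"
    unfolding matrix_inv_def by (rule_tac someI[of _ "transpose A"]) simp
  then show ?thesis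
    by (metis A(2) matrix_mul_assoc matrix_mul_lid matrix_mul_rid)
qed

lemma orthogonal_group_mult: "A \<in> orthogonal_group \<Longrightarrow> B \<in> orthogonal_group \<Longrightarrow> A ** B \<in> orthogonal_group"
  for A :: "real^'n^'n"
  by (simp add: orthogonal_group_def orthogonal_matrix_mul)

lemma orthogonal_group_inv: "A \<in> orthogonal_group \<Longrightarrow> matrix_inv A \<in> orthogonal_group"
  for A :: "real^'n^'n"
  by (simp add: matrix_inv_orthogonal) (simp add: orthogonal_group_def)

lemma orthogonal_group_inv_cancel:
  fixes A :: "real^'n^'n"
  assumes "A \<in> orthogonal_group"
  shows "A ** matrix_inv A = mat 1" "matrix_inv A ** A = mat 1"
  unfolding matrix_inv_orthogonal[OF assms]
  using assms by (auto simp: orthogonal_group_def orthogonal_matrix_def)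

lemma norm_orthogonal_group: "A \<in> orthogonal_group \<Longrightarrow> norm (A *v v) = norm v"
  for A :: "real^'n^'n"
  using orthogonal_transformation_norm by (auto simp: in_orthogonal_group_iff)

text \<open>Closed as the solution set of a continuous equation, and bounded because every row is a
  unit vector.\<close>

lemma compact_orthogonal_group: "compact (orthogonal_group :: (real^'n^'n) set)"
proof -
  have "closed {A :: real^'n^'n. transpose A ** A = mat 1}"
    by (intro closed_Collect_eq continuous_intros)
  then have "closed (orthogonal_group :: (real^'n^'n) set)"
    by (simp add: orthogonal_group_def orthogonal_matrix)
  moreover have "norm A \<le> CARD('n)" if "A \<in> orthogonal_group" for A :: "real^'n^'n"
  proof -
    have "norm (A $ i) = 1" for i
      using that orthogonal_matrix_orthonormal_rows[of A]
      by (simp add: orthogonal_group_def row_def)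
    then show ?thesis
      using L2_set_le_sum[of UNIV "\<lambda>i. norm (A $ i)"] by (simp add: norm_vec_def)
  qed
  ultimately show ?thesis
    by (auto simp: compact_eq_bounded_closed bounded_iff)
qed

text \<open>The definition appends factors at the end of the orbit; here the first factor is split
  off instead, so that \<open>\<Psi> x\<close> can cancel it.\<close>

lemma inv_cocycle_shift:
  "inv_cocycle T \<Psi> (Suc j) x = matrix_inv (\<Psi> x) ** inv_cocycle T \<Psi> j (T x)"
proof (induction j)
  case (Suc j)
  have "inv_cocycle T \<Psi> (Suc (Suc j)) x
      = inv_cocycle T \<Psi> (Suc j) x ** matrix_inv (\<Psi> ((T ^^ Suc j) (T x)))"
    by (simp add: funpow_swap1)
  also have "\<dots> = matrix_inv (\<Psi> x) ** inv_cocycle T \<Psi> (Suc j) (T x)"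
    unfolding Suc.IH by (simp add: matrix_mul_assoc)
  finally show ?case .
qed simp

text \<open>The exponent is \<open>Suc j\<close> because \<open>inv_cocycle T \<Psi> j\<close> has
  \<open>j + 1\<close> factors.\<close>

lemma skew_extension_funpow:
  "(skew_extension T \<Psi> ^^ Suc j) (x, A) = ((T ^^ Suc j) x, A ** inv_cocycle T \<Psi> j x)"
proof (induction j)
  case (Suc j)
  have "(skew_extension T \<Psi> ^^ Suc (Suc j)) (x, A)
      = skew_extension T \<Psi> ((skew_extension T \<Psi> ^^ Suc j) (x, A))"
    by simp
  then show ?case
    unfolding Suc.IH by (simp add: skew_extension_def matrix_mul_assoc)
qed (simp add: skew_extension_def)

lemma exp_mean_eq_abel_mean:
  "exp_mean T \<Psi> s u x = abel_mean s (\<lambda>j. inv_cocycle T \<Psi> j x *v u ((T ^^ Suc j) x))"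
  by (simp add: exp_mean_def abel_mean_def)

lemma eventually_at_left_1: "\<forall>\<^sub>F s in at_left (1::real). 0 < s \<and> s < 1"
  by (auto simp: eventually_at_left[of 0] intro!: exI[of _ 0])

section \<open>Exponential means and the hyperbolized equation\<close>

locale orthogonal_cocycle =
  fixes X :: "'a::metric_space set"
    and T :: "'a \<Rightarrow> 'a"
    and \<Psi> :: "'a \<Rightarrow> real^'l^'l"
  assumes compact: "compact X"
    and T: "continuous_on X T" "T ` X \<subseteq> X"
    and \<Psi>: "continuous_on X \<Psi>" "\<Psi> ` X \<subseteq> orthogonal_group"
begin

lemma funpow_T: "x \<in> X \<Longrightarrow> (T ^^ j) x \<in> X"
  by (rule funpow_in[OF T(2)])

lemma T_in: "x \<in> X \<Longrightarrow> T x \<in> X"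
  using T(2) by blast

lemma \<Psi>_in: "x \<in> X \<Longrightarrow> \<Psi> x \<in> orthogonal_group"
  using \<Psi>(2) by blast

lemma continuous_on_matrix_inv: "continuous_on X (\<lambda>x. matrix_inv (\<Psi> x))"
  by (rule continuous_on_eq[OF continuous_on_transpose[OF \<Psi>(1)]])
    (simp add: matrix_inv_orthogonal \<Psi>_in)

lemma inv_cocycle_in: "x \<in> X \<Longrightarrow> inv_cocycle T \<Psi> j x \<in> orthogonal_group"
proof (induction j)
  case (Suc j)
  then show ?case
    using funpow_T[of x "Suc j"]
    by (auto intro!: orthogonal_group_mult orthogonal_group_inv \<Psi>_in)
qed (simp add: orthogonal_group_inv \<Psi>_in)

lemma continuous_on_inv_cocycle: "continuous_on X (inv_cocycle T \<Psi> j)"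
proof (induction j)
  case (Suc j)
  have "continuous_on X (\<lambda>x. matrix_inv (\<Psi> ((T ^^ Suc j) x)))"
    by (rule continuous_on_compose2[OF continuous_on_matrix_inv continuous_on_funpow[OF T]])
      (use funpow_T in blast)
  with Suc show ?case by (simp add: continuous_on_matrix_mult)
qed (simp add: continuous_on_matrix_inv)

lemma norm_inv_cocycle: "x \<in> X \<Longrightarrow> norm (inv_cocycle T \<Psi> j x *v v) = norm v"
  by (rule norm_orthogonal_group[OF inv_cocycle_in])

text \<open>\<open>\<Psi> x\<close> cancels the first factor of every term, which leaves an Abel
  mean along the orbit of \<open>T x\<close> whose first term is \<open>u (T x)\<close>; splitting
  that term off gives the recurrence.\<close>

lemma \<Psi>_exp_mean:
  assumes s: "0 < s" "s < 1" and u: "continuous_on X u" and x: "x \<in> X"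
  shows "\<Psi> x *v exp_mean T \<Psi> s u x = (1 - s) *\<^sub>R u (T x) + s *\<^sub>R exp_mean T \<Psi> s u (T x)"
proof -
  obtain B where "0 \<le> B" and B: "\<And>y. y \<in> X \<Longrightarrow> norm (u y) \<le> B"
    using continuous_compact_norm_bound[OF u compact] by blast
  define a where "a j = inv_cocycle T \<Psi> j x *v u ((T ^^ Suc j) x)" for j
  have a: "norm (a j) \<le> B" for j
    unfolding a_def norm_inv_cocycle[OF x] by (intro B funpow_T x)
  have "\<Psi> x *v abel_mean s a = abel_mean s (\<lambda>j. \<Psi> x *v a j)"
    by (rule bounded_linear_abel_mean[OF s a matrix_vector_mul_bounded_linear])
  also have "\<dots> = (1 - s) *\<^sub>R (\<Psi> x *v a 0) + s *\<^sub>R abel_mean s (\<lambda>j. \<Psi> x *v a (Suc j))"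
    by (rule abel_mean_Suc[OF s, of _ B]) (simp add: norm_orthogonal_group \<Psi>_in x a)
  also have "\<Psi> x *v a 0 = u (T x)"
    by (simp add: a_def matrix_vector_mul_assoc orthogonal_group_inv_cancel \<Psi>_in x)
  also have "(\<lambda>j. \<Psi> x *v a (Suc j)) = (\<lambda>j. inv_cocycle T \<Psi> j (T x) *v u ((T ^^ Suc j) (T x)))"
  proof
    fix j
    have "\<Psi> x ** inv_cocycle T \<Psi> (Suc j) x = inv_cocycle T \<Psi> j (T x)"
      unfolding inv_cocycle_shift by (simp add: matrix_mul_assoc orthogonal_group_inv_cancel \<Psi>_in x)
    then show "\<Psi> x *v a (Suc j) = inv_cocycle T \<Psi> j (T x) *v u ((T ^^ Suc j) (T x))"
      unfolding a_def matrix_vector_mul_assoc by (simp add: funpow_swap1 del: inv_cocycle.simps)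
  qed
  finally show ?thesis
    by (simp add: exp_mean_eq_abel_mean a_def)
qed

text \<open>The Weierstrass test with a geometric majorant applies, since the cocycle preserves
  norms and \<open>u\<close> is bounded.\<close>

lemma continuous_on_exp_mean:
  assumes s: "0 < s" "s < 1" and u: "continuous_on X u"
  shows "continuous_on X (exp_mean T \<Psi> s u)"
proof -
  obtain B where "0 \<le> B" and B: "\<And>y. y \<in> X \<Longrightarrow> norm (u y) \<le> B"
    using continuous_compact_norm_bound[OF u compact] by blast
  define f where "f j x = s ^ j *\<^sub>R (inv_cocycle T \<Psi> j x *v u ((T ^^ Suc j) x))" for j x
  have "continuous_on X (\<lambda>x. u ((T ^^ Suc j) x))" for j
    by (rule continuous_on_compose2[OF u continuous_on_funpow[OF T]]) (use funpow_T in blast)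
  then have f: "continuous_on X (f j)" for j
    unfolding f_def by (intro continuous_intros continuous_on_inv_cocycle)
  have "norm (f j x) \<le> s ^ j * B" if "x \<in> X" for j x
    unfolding f_def
    by (rule norm_abel_term_le[OF s]) (use B funpow_T T_in that in \<open>auto simp: norm_inv_cocycle\<close>)
  then have "uniform_limit X (\<lambda>n x. \<Sum>j<n. f j x) (\<lambda>x. suminf (\<lambda>j. f j x)) sequentially"
    \<comment> \<open>The zero sequence is a placeholder that reduces the boundedness premise to
      \<open>0 \<le> B\<close>.\<close>
    by (rule Weierstrass_m_test[OF _ sums_summable[OF sums_geometric_bound[OF s, of "\<lambda>_. 0 :: real"]]])
      (use \<open>0 \<le> B\<close> in auto)
  then have "continuous_on X (\<lambda>x. suminf (\<lambda>j. f j x))"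
    by (rule uniform_limit_theorem[rotated])
      (auto intro!: always_eventually continuous_on_sum f)
  then show ?thesis
    unfolding exp_mean_def f_def by (intro continuous_intros)
qed

text \<open>A maximum principle: where the norm \<open>d\<close> of the difference is largest, the
  isometry gives \<open>d z = s * d (T z) \<le> s * d z\<close>, hence
  \<open>d z = 0\<close>.\<close>

lemma hyperbolized_solution_unique:
  assumes s: "0 < s" "s < 1"
    and v: "hyperbolized_solution X T \<Psi> \<rho> s v" and w: "hyperbolized_solution X T \<Psi> \<rho> s w"
    and x: "x \<in> X"
  shows "v x = w x"
proof -
  define d where "d x = norm (v x - w x)" for x
  have "continuous_on X d"
    unfolding d_def using v w by (intro continuous_intros) (auto simp: hyperbolized_solution_def)
  then obtain z where z: "z \<in> X" "\<And>y. y \<in> X \<Longrightarrow> d y \<le> d z"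
    using continuous_attains_sup[OF compact] x by blast
  have "s *\<^sub>R v (T z) - \<Psi> z *v v z = s *\<^sub>R w (T z) - \<Psi> z *v w z"
    using v w z(1) by (simp add: hyperbolized_solution_def)
  then have "\<Psi> z *v (v z - w z) = s *\<^sub>R (v (T z) - w (T z))"
    by (simp add: matrix_vector_mult_diff_distrib scaleR_diff_right algebra_simps)
  then have "d z = s * d (T z)"
    using norm_orthogonal_group[OF \<Psi>_in[OF z(1)], of "v z - w z"] s by (simp add: d_def)
  also have "\<dots> \<le> s * d z"
    using z T_in s by (intro mult_left_mono) auto
  finally have "(1 - s) * d z \<le> 0" by (simp add: algebra_simps)
  then have "d z \<le> 0" using s by (simp add: mult_le_0_iff)
  then have "d x \<le> 0" using z(2)[OF x] by linarith
  then show ?thesis by (simp add: d_def)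
qed

lemma u_hyp_eq:
  assumes s: "0 < s" "s < 1" and u: "twisted_solution X T \<Psi> \<rho> u" and x: "x \<in> X"
  shows "u_hyp X T \<Psi> \<rho> s x = u x - exp_mean T \<Psi> s u x"
proof -
  \<comment> \<open>The restriction makes \<open>w\<close> extensional, as the description defining
    \<open>u_hyp\<close> requires.\<close>
  define w where "w = restrict (\<lambda>x. u x - exp_mean T \<Psi> s u x) X"
  have cu: "continuous_on X u" and eq: "\<And>x. x \<in> X \<Longrightarrow> u (T x) - \<Psi> x *v u x = \<rho> x"
    using u by (auto simp: twisted_solution_def)
  have "continuous_on X w"
    by (rule continuous_on_eq[OF continuous_on_diff[OF cu continuous_on_exp_mean[OF s cu]]])
      (simp add: w_def)
  moreover have "s *\<^sub>R w (T y) - \<Psi> y *v w y = \<rho> y" if y: "y \<in> X" for y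
  proof -
    have "s *\<^sub>R w (T y) - \<Psi> y *v w y = s *\<^sub>R (u (T y) - exp_mean T \<Psi> s u (T y))
        - (\<Psi> y *v u y - ((1 - s) *\<^sub>R u (T y) + s *\<^sub>R exp_mean T \<Psi> s u (T y)))"
      using y T_in[OF y] \<Psi>_exp_mean[OF s cu y] by (simp add: w_def matrix_vector_mult_diff_distrib)
    also have "\<dots> = \<rho> y"
      using eq[OF y] by (simp add: algebra_simps)
    finally show ?thesis .
  qed
  ultimately have w: "w \<in> extensional X \<and> hyperbolized_solution X T \<Psi> \<rho> s w"
    by (simp add: w_def hyperbolized_solution_def)
  have "u_hyp X T \<Psi> \<rho> s = w"
    unfolding u_hyp_def
  proof (rule the_equality, rule w)
    fix v assume v: "v \<in> extensional X \<and> hyperbolized_solution X T \<Psi> \<rho> s v"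
    show "v = w"
      by (rule extensionalityI[of _ X]) (use v w hyperbolized_solution_unique[OF s] in blast)+
  qed
  then show ?thesis using x by (simp add: w_def)
qed

text \<open>The common end of both cases: once the exponential means of one solution converge
  uniformly, to any limit function, all the claims follow.\<close>

lemma convergence_of_hyperbolized_solutions:
  assumes u: "twisted_solution X T \<Psi> \<rho> u"
    and S: "uniform_limit X (\<lambda>s. exp_mean T \<Psi> s u) S (at_left 1)"
  shows "\<exists>u_star. uniform_limit X (u_hyp X T \<Psi> \<rho>) u_star (at_left 1) \<and>
    twisted_solution X T \<Psi> \<rho> u_star \<and> uniform_exp_zero_mean X T \<Psi> u_star"
proof -
  define w where "w x = u x - S x" for x
  have cu: "continuous_on X u" using u by (simp add: twisted_solution_def)
  have lim: "uniform_limit X (u_hyp X T \<Psi> \<rho>) w (at_left 1)"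
  proof (rule uniform_limit_cong[THEN iffD1])
    show "uniform_limit X (\<lambda>s x. u x - exp_mean T \<Psi> s u x) w (at_left 1)"
      unfolding w_def by (intro uniform_limit_intros S)
    show "\<forall>\<^sub>F s in at_left 1. \<forall>x\<in>X. u x - exp_mean T \<Psi> s u x = u_hyp X T \<Psi> \<rho> s x"
      using eventually_at_left_1 by eventually_elim (simp add: u_hyp_eq[OF _ _ u])
  qed simp
  have ptw: "((\<lambda>s. u x - exp_mean T \<Psi> s u x) \<longlongrightarrow> w x) (at_left 1)" if "x \<in> X" for x
    unfolding w_def by (intro tendsto_intros tendsto_uniform_limitI[OF S that])
  have "continuous_on X S"
    by (rule uniform_limit_theorem[OF _ S])
      (use eventually_at_left_1 in \<open>auto elim!: eventually_mono intro: continuous_on_exp_mean[OF _ _ cu]\<close>)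
  then have cw: "continuous_on X w"
    unfolding w_def by (intro continuous_intros cu)
  \<comment> \<open>Obtained by letting \<open>s\<close> tend to 1 in the hyperbolized
    equation.\<close>
  have eq: "w (T x) - \<Psi> x *v w x = \<rho> x" if x: "x \<in> X" for x
  proof -
    have "((\<lambda>s. s *\<^sub>R (u (T x) - exp_mean T \<Psi> s u (T x)) - \<Psi> x *v (u x - exp_mean T \<Psi> s u x))
        \<longlongrightarrow> 1 *\<^sub>R w (T x) - \<Psi> x *v w x) (at_left 1)"
      by (intro tendsto_intros ptw x T_in bounded_linear.tendsto[OF matrix_vector_mul_bounded_linear])
    moreover have "s *\<^sub>R (u (T x) - exp_mean T \<Psi> s u (T x)) - \<Psi> x *v (u x - exp_mean T \<Psi> s u x) = \<rho> x"
      if s: "0 < s \<and> s < 1" for s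
    proof -
      have "u (T x) - \<Psi> x *v u x = \<rho> x" using u x by (simp add: twisted_solution_def)
      with \<Psi>_exp_mean[OF _ _ cu x, of s] s show ?thesis
        by (simp add: matrix_vector_mult_diff_distrib algebra_simps)
    qed
    then have "((\<lambda>s. s *\<^sub>R (u (T x) - exp_mean T \<Psi> s u (T x)) - \<Psi> x *v (u x - exp_mean T \<Psi> s u x))
        \<longlongrightarrow> \<rho> x) (at_left 1)"
      by (intro tendsto_eventually eventually_mono[OF eventually_at_left_1])
    ultimately show ?thesis
      using tendsto_unique[OF trivial_limit_at_left_real] by fastforce
  qed
  have w: "twisted_solution X T \<Psi> \<rho> w"
    using cw eq by (simp add: twisted_solution_def)
  \<comment> \<open>\<open>u_hyp\<close> does not depend on the chosen solution, so
    \<open>u_hyp_eq\<close> may be used again with \<open>w\<close> in place of \<open>u\<close>: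
    the exponential mean of \<open>w\<close> is \<open>w\<close> minus a family that converges to
    \<open>w\<close>.\<close>
  have "uniform_limit X (\<lambda>s x. w x - u_hyp X T \<Psi> \<rho> s x) (\<lambda>x. w x - w x) (at_left 1)"
    by (intro uniform_limit_intros lim)
  then have "uniform_limit X (\<lambda>s. exp_mean T \<Psi> s w) (\<lambda>x. 0) (at_left 1)"
  proof (rule uniform_limit_cong[THEN iffD1, rotated 2])
    show "\<forall>\<^sub>F s in at_left 1. \<forall>x\<in>X. w x - u_hyp X T \<Psi> \<rho> s x = exp_mean T \<Psi> s w x"
      using eventually_at_left_1 by eventually_elim (simp add: u_hyp_eq[OF _ _ w])
  qed simp
  moreover have "bounded (w ` X)"
    by (rule compact_imp_bounded[OF compact_continuous_image[OF cw compact]])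
  ultimately show ?thesis
    using lim w unfolding uniform_exp_zero_mean_def by blast
qed

section \<open>Convergence of the exponential means in the two cases\<close>

lemma exp_mean_limit_of_uniquely_ergodic_skew_extension:
  assumes ue: "uniquely_ergodic (X \<times> orthogonal_group) (skew_extension T \<Psi>)"
    and u: "continuous_on X u"
  shows "\<exists>S. uniform_limit X (\<lambda>s. exp_mean T \<Psi> s u) S (at_left 1)"
proof -
  let ?Y = "X \<times> orthogonal_group :: ('a \<times> (real^'l^'l)) set"
  let ?F = "skew_extension T \<Psi>"
  define g where "g p = snd p *v u (fst p)" for p :: "'a \<times> (real^'l^'l)"
  have "continuous_on ?Y g"
    unfolding g_def by (intro continuous_intros continuous_on_compose2[OF u]) auto
  moreover have "compact ?Y"
    by (intro compact_Times compact compact_orthogonal_group)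
  moreover have "continuous_on ?Y ?F"
    unfolding skew_extension_def case_prod_beta
    by (intro continuous_intros continuous_on_compose2[OF T(1)]
        continuous_on_compose2[OF continuous_on_matrix_inv]) auto
  moreover have F: "?F ` ?Y \<subseteq> ?Y"
    by (auto simp: skew_extension_def T_in intro!: orthogonal_group_mult orthogonal_group_inv \<Psi>_in)
  ultimately obtain c where
    c: "uniform_limit ?Y (\<lambda>s y. abel_mean s (\<lambda>j. g ((?F ^^ j) y))) (\<lambda>_. c) (at_left 1)"
    using uniquely_ergodic_abel_mean[OF _ ue] by blast
  \<comment> \<open>Exponential means begin with one factor and the point \<open>T x\<close>, so the
    orbit is started at the image of \<open>(x, mat 1)\<close>.\<close>
  have "(\<lambda>x. ?F (x, mat 1)) \<in> X \<rightarrow> ?Y"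
    using F by (force simp: orthogonal_group_def orthogonal_matrix_id)
  from uniform_limit_compose'[OF c this]
  have "uniform_limit X (\<lambda>s x. abel_mean s (\<lambda>j. g ((?F ^^ Suc j) (x, mat 1)))) (\<lambda>_. c) (at_left 1)"
    by (simp add: funpow_swap1)
  then show ?thesis
    unfolding skew_extension_funpow g_def fst_conv snd_conv matrix_mul_lid
      exp_mean_eq_abel_mean[symmetric] by blast
qed

text \<open>The section untwists the cocycle: after multiplication by \<open>\<X> x\<close>, the
  terms of the exponential mean become values of the single function \<open>g\<close> along the
  orbit in \<open>X\<close>, where \<open>T\<close> itself is uniquely ergodic.\<close>

lemma exp_mean_limit_of_invariant_section:
  assumes ue: "uniquely_ergodic X T" and sec: "invariant_section X T \<Psi> \<X>"
    and u: "continuous_on X u"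
  shows "\<exists>S. uniform_limit X (\<lambda>s. exp_mean T \<Psi> s u) S (at_left 1)"
proof -
  have \<X>: "continuous_on X \<X>" "\<And>x. x \<in> X \<Longrightarrow> \<X> x \<in> orthogonal_group"
    "\<And>x. x \<in> X \<Longrightarrow> \<X> x ** matrix_inv (\<Psi> x) = \<X> (T x)"
    using sec by (auto simp: invariant_section_def skew_extension_def)
  define g where "g x = \<X> x *v u x" for x
  have cg: "continuous_on X g"
    unfolding g_def by (intro continuous_intros \<X> u)
  then obtain B where "0 \<le> B" and B: "\<And>y. y \<in> X \<Longrightarrow> norm (g y) \<le> B"
    using continuous_compact_norm_bound[OF cg compact] by blast
  obtain c where c: "uniform_limit X (\<lambda>s y. abel_mean s (\<lambda>j. g ((T ^^ j) y))) (\<lambda>_. c) (at_left 1)"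
    using uniquely_ergodic_abel_mean[OF compact ue T cg] by blast
  have "T \<in> X \<rightarrow> X" using T_in by blast
  from uniform_limit_compose'[OF c this]
  have c': "uniform_limit X (\<lambda>s x. abel_mean s (\<lambda>j. g ((T ^^ Suc j) x))) (\<lambda>_. c) (at_left 1)"
    by (simp add: funpow_swap1)
  \<comment> \<open>The product telescopes, since invariance absorbs one inverse factor at each
    step.\<close>
  have coc: "\<X> x ** inv_cocycle T \<Psi> j x = \<X> ((T ^^ Suc j) x)" if x: "x \<in> X" for j x
  proof (induction j)
    case (Suc j)
    show ?case
      using \<X>(3)[OF funpow_T[OF x, of "Suc j"]] Suc by (simp add: matrix_mul_assoc)
  qed (simp add: \<X>(3) x)
  have eq: "exp_mean T \<Psi> s u x = matrix_inv (\<X> x) *v abel_mean s (\<lambda>j. g ((T ^^ Suc j) x))"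
    if s: "0 < s" "s < 1" and x: "x \<in> X" for s x
  proof -
    have "matrix_inv (\<X> x) *v abel_mean s (\<lambda>j. g ((T ^^ Suc j) x))
        = abel_mean s (\<lambda>j. matrix_inv (\<X> x) *v g ((T ^^ Suc j) x))"
      by (rule bounded_linear_abel_mean[OF s, of _ B])
        (use B funpow_T x in \<open>auto simp: matrix_vector_mul_bounded_linear T_in\<close>)
    also have "(\<lambda>j. matrix_inv (\<X> x) *v g ((T ^^ Suc j) x))
        = (\<lambda>j. inv_cocycle T \<Psi> j x *v u ((T ^^ Suc j) x))"
      unfolding g_def coc[OF x, symmetric]
      by (simp add: matrix_vector_mul_assoc matrix_mul_assoc orthogonal_group_inv_cancel \<X>(2) x)
    finally show ?thesis by (simp add: exp_mean_eq_abel_mean)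
  qed
  \<comment> \<open>The limit varies with \<open>x\<close>, but uniformity survives because
    \<open>matrix_inv (\<X> x)\<close> is an isometry for every \<open>x\<close> in
    \<open>X\<close>.\<close>
  have "uniform_limit X (\<lambda>s. exp_mean T \<Psi> s u) (\<lambda>x. matrix_inv (\<X> x) *v c) (at_left 1)"
  proof (rule uniform_limitI)
    fix e :: real assume "e > 0"
    with uniform_limitD[OF c'] eventually_at_left_1
    show "\<forall>\<^sub>F s in at_left 1. \<forall>x\<in>X. dist (exp_mean T \<Psi> s u x) (matrix_inv (\<X> x) *v c) < e"
    proof (elim eventually_elim2[rotated], intro ballI)
      fix s x
      assume s: "0 < s \<and> s < 1" and x: "x \<in> X"
        and d: "\<forall>x\<in>X. dist (abel_mean s (\<lambda>j. g ((T ^^ Suc j) x))) c < e"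
      have "dist (exp_mean T \<Psi> s u x) (matrix_inv (\<X> x) *v c)
          = norm (matrix_inv (\<X> x) *v (abel_mean s (\<lambda>j. g ((T ^^ Suc j) x)) - c))"
        using eq[OF _ _ x] s by (simp add: dist_norm matrix_vector_mult_diff_distrib)
      also have "\<dots> = dist (abel_mean s (\<lambda>j. g ((T ^^ Suc j) x))) c"
        by (simp add: dist_norm norm_orthogonal_group orthogonal_group_inv \<X>(2) x)
      also have "\<dots> < e" using d x by blast
      finally show "dist (exp_mean T \<Psi> s u x) (matrix_inv (\<X> x) *v c) < e" .
    qed
  qed
  then show ?thesis by blast
qed

end

theorem theorem19:
  fixes X :: "'a::metric_space set"
    and T :: "'a \<Rightarrow> 'a"
    and \<Psi> :: "'a \<Rightarrow> real^'l^'l"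
    and \<rho> :: "'a \<Rightarrow> real^'l"
  assumes "compact X"
    and "\<exists>T'. homeomorphism X X T T'"
    and "uniquely_ergodic X T"
    and "continuous_on X \<Psi>" and "\<Psi> ` X \<subseteq> orthogonal_group"
    and "continuous_on X \<rho>"
    and "\<exists>u. twisted_solution X T \<Psi> \<rho> u"
  shows "(uniquely_ergodic (X \<times> orthogonal_group) (skew_extension T \<Psi>) \<longrightarrow>
           (\<exists>u_star. uniform_limit X (u_hyp X T \<Psi> \<rho>) u_star (at_left 1) \<and>
              twisted_solution X T \<Psi> \<rho> u_star \<and> uniform_exp_zero_mean X T \<Psi> u_star)) \<and>
         ((\<exists>\<X>. invariant_section X T \<Psi> \<X>) \<longrightarrow>
           (\<exists>u_star. uniform_limit X (u_hyp X T \<Psi> \<rho>) u_star (at_left 1) \<and>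
              twisted_solution X T \<Psi> \<rho> u_star \<and> uniform_exp_zero_mean X T \<Psi> u_star))"
proof -
  have "continuous_on X T" "T ` X \<subseteq> X"
    using assms(2) by (auto simp: homeomorphism_def)
  then interpret orthogonal_cocycle X T \<Psi>
    using assms(1,4,5) by unfold_locales
  obtain u where u: "twisted_solution X T \<Psi> \<rho> u" using assms(7) by blast
  then have "continuous_on X u" by (simp add: twisted_solution_def)
  then show ?thesis
    using convergence_of_hyperbolized_solutions[OF u]
      exp_mean_limit_of_uniquely_ergodic_skew_extension
      exp_mean_limit_of_invariant_section[OF assms(3)] by blast
qed

end
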